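(* Assume $\mathrm{FPT}\neq\#\mathrm{W}[2]$. Then there is no associative binary operator $\boxplus$ on hypergraphs that is fixed-parameter tractable and satisfies, for all hypergraphs $F,G,H$, $$\#\mathrm{TrimHom}(F,G\boxplus H)=\#\mathrm{TrimHom}(F,G)\cdot\#\mathrm{TrimHom}(F,H).$$
   Context: A hypergraph is a pair $H=(V,E)$ with $V$ finite and $E\subseteq2^V\setminus\{\varnothing\}$. A trimmed homomorphism from $F$ to $G$ is a map $\varphi:V(F)\to V(G)$ such that for every $e\in E(F)$ there is $e'\in E(G)$ with $\varphi(e)=e'\cap\mathrm{img}(\varphi)$; $\mathrm{TrimHom}(F,G)$ is the set of these. An associative hypergraph product is a map $\boxplus$ from pairs of hypergraphs to hypergraphs with $F\boxplus(G\boxplus H)\cong(F\boxplus G)\boxplus H$ for all $F,G,H$; it is fixed-parameter tractable if there is a computable $f$ and an algorithm computing $G\boxplus H$ in time $f(|V(H)|)\cdot|G|^{O(1)}$. $\mathrm{FPT}\neq\#\mathrm{W}[2]$ is the hypothesis that counting dominating sets of size $k$ in a graph (parameter $k$) is not fixed-parameter tractable (i.e. not solvable in time $f(k)\cdot n^{O(1)}$). *)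

theory Defs
  imports Main "HOL-Library.FuncSet"
begin

section \<open>Hypergraphs and trimmed homomorphisms\<close>

typedef 'v hypergraph =
  "{(V :: 'v set, E :: 'v set set). finite V \<and> E \<subseteq> Pow V - {{}}}"
  by (rule exI[of _ "({}, {})"]) simp

definition vertices :: "'v hypergraph \<Rightarrow> 'v set" where
  "vertices G = fst (Rep_hypergraph G)"

definition edges :: "'v hypergraph \<Rightarrow> 'v set set" where
  "edges G = snd (Rep_hypergraph G)"

text \<open>Extensional functions, so that each map between the vertex sets is counted once.\<close>

definition TrimHom :: "'a hypergraph \<Rightarrow> 'b hypergraph \<Rightarrow> ('a \<Rightarrow> 'b) set" where
  "TrimHom F G =
     {\<phi> \<in> vertices F \<rightarrow>\<^sub>E vertices G.
        \<forall>e\<in>edges F. \<exists>e'\<in>edges G. \<phi> ` e = e' \<inter> \<phi> ` vertices F}"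

definition isomorphic :: "'a hypergraph \<Rightarrow> 'b hypergraph \<Rightarrow> bool" (infix "\<simeq>" 50) where
  "G \<simeq> H \<longleftrightarrow>
     (\<exists>b. bij_betw b (vertices G) (vertices H) \<and> (\<lambda>e. b ` e) ` edges G = edges H)"

text \<open>Finite hypergraphs are considered up to isomorphism, so vertices may be taken to be
  natural numbers.\<close>

type_synonym hypergraph_product = "nat hypergraph \<Rightarrow> nat hypergraph \<Rightarrow> nat hypergraph"

definition associative_product :: "hypergraph_product \<Rightarrow> bool" where
  "associative_product p \<longleftrightarrow> (\<forall>F G H. p F (p G H) \<simeq> p (p F G) H)"


section \<open>Turing machines\<close>

text \<open>Deterministic machines with one two-way infinite tape. Such a machine is its transition
  table, mapping a state and the scanned symbol to the next state, the symbol written and the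
  head movement; it halts where the table is undefined. As the table is finite, only
  finitely many states and symbols matter. State \<open>0\<close> is initial and symbol \<open>0\<close> is the blank.\<close>

datatype move = Left | Stay | Right

type_synonym tm = "nat \<times> nat \<Rightarrow> (nat \<times> nat \<times> move) option"

type_synonym config = "nat \<times> (int \<Rightarrow> nat) \<times> int"

definition turing_machine :: "tm \<Rightarrow> bool" where
  "turing_machine M \<longleftrightarrow> finite (dom M)"

fun shift :: "move \<Rightarrow> int" where
  "shift Left = -1"
| "shift Stay = 0"
| "shift Right = 1"

fun halted :: "tm \<Rightarrow> config \<Rightarrow> bool" where
  "halted M (q, tape, h) \<longleftrightarrow> M (q, tape h) = None"

fun step :: "tm \<Rightarrow> config \<Rightarrow> config" where
  "step M (q, tape, h) =
     (case M (q, tape h) of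
        None \<Rightarrow> (q, tape, h)
      | Some (q', a, d) \<Rightarrow> (q', tape(h := a), h + shift d))"

definition symbol_of_bit :: "bool \<Rightarrow> nat" where
  "symbol_of_bit b = (if b then 2 else 1)"

definition initial :: "bool list \<Rightarrow> config" where
  "initial w =
     (0, \<lambda>i. if 0 \<le> i \<and> i < int (length w) then symbol_of_bit (w ! nat i) else 0, 0)"

text \<open>The output is the word that starts at cell \<open>0\<close> and ends before the next blank.\<close>

fun is_output :: "config \<Rightarrow> bool list \<Rightarrow> bool" where
  "is_output (q, tape, h) u \<longleftrightarrow>
     (\<forall>i<length u. tape (int i) = symbol_of_bit (u ! i)) \<and> tape (int (length u)) = 0"

text \<open>On input \<open>w\<close>, machine \<open>M\<close> halts after at most \<open>t\<close> steps with an output satisfying \<open>P\<close>.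
  Halted configurations are fixed points of \<^term>\<open>step\<close>, so it suffices to inspect the
  configuration at time \<open>t\<close>.\<close>

definition outputs_within :: "tm \<Rightarrow> bool list \<Rightarrow> nat \<Rightarrow> (bool list \<Rightarrow> bool) \<Rightarrow> bool" where
  "outputs_within M w t P \<longleftrightarrow>
     (let c = (step M ^^ t) (initial w) in halted M c \<and> (\<exists>u. is_output c u \<and> P u))"


section \<open>Encodings\<close>

definition unary :: "nat \<Rightarrow> bool list" where
  "unary n = replicate n True @ [False]"

text \<open>Binary representation, least significant bit first.\<close>

definition binary_rep :: "bool list \<Rightarrow> nat \<Rightarrow> bool" where
  "binary_rep u n \<longleftrightarrow> horner_sum of_bool 2 u = n"

text \<open>A hypergraph is given to a machine by the numbers of its vertices and edges followed by
  its incidence matrix, with respect to arbitrary enumerations of the vertices and the edges.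
  Such words are self-delimiting, so inputs with several components are simply concatenated.
  The names of the vertices are not recorded: isomorphic hypergraphs have the same encodings, and
  the length of an encoding depends only on the numbers of vertices and edges.\<close>

definition encodes :: "bool list \<Rightarrow> 'v hypergraph \<Rightarrow> bool" where
  "encodes w G \<longleftrightarrow>
     (\<exists>vs es. distinct vs \<and> set vs = vertices G \<and> distinct es \<and> set es = edges G \<and>
        w = unary (length vs) @ unary (length es) @
            concat (map (\<lambda>e. map (\<lambda>v. v \<in> e) vs) es))"


section \<open>Fixed-parameter tractability\<close>

definition computable :: "(nat \<Rightarrow> nat) \<Rightarrow> bool" where
  "computable f \<longleftrightarrow>
     (\<exists>M. turing_machine M \<and>
        (\<forall>n. \<exists>t. outputs_within M (unary n) t (\<lambda>u. binary_rep u (f n))))"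

text \<open>The size \<open>|G|\<close> is the length of the encoding of \<open>G\<close> on the input tape.\<close>

definition fpt_product :: "hypergraph_product \<Rightarrow> bool" where
  "fpt_product p \<longleftrightarrow>
     (\<exists>M f c. turing_machine M \<and> computable f \<and>
        (\<forall>G H g h. encodes g G \<longrightarrow> encodes h H \<longrightarrow>
           outputs_within M (g @ h) (f (card (vertices H)) * length g ^ c)
             (\<lambda>u. encodes u (p G H))))"

definition is_graph :: "'v hypergraph \<Rightarrow> bool" where
  "is_graph G \<longleftrightarrow> (\<forall>e\<in>edges G. card e = 2)"

definition dominating_set :: "'v hypergraph \<Rightarrow> 'v set \<Rightarrow> bool" where
  "dominating_set G D \<longleftrightarrow>
     D \<subseteq> vertices G \<and> (\<forall>v\<in>vertices G. v \<in> D \<or> (\<exists>u\<in>D. {u, v} \<in> edges G))"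

definition num_dominating_sets :: "'v hypergraph \<Rightarrow> nat \<Rightarrow> nat" where
  "num_dominating_sets G k = card {D. dominating_set G D \<and> card D = k}"

definition fpt_counting_dominating_sets :: bool where
  "fpt_counting_dominating_sets \<longleftrightarrow>
     (\<exists>M f c. turing_machine M \<and> computable f \<and>
        (\<forall>(G :: nat hypergraph) k g. is_graph G \<longrightarrow> encodes g G \<longrightarrow>
           outputs_within M (unary k @ g) (f k * length g ^ c)
             (\<lambda>u. binary_rep u (num_dominating_sets G k))))"

definition FPT_neq_sharpW2 :: bool where
  "FPT_neq_sharpW2 \<longleftrightarrow> \<not> fpt_counting_dominating_sets"

end

theory Submission
  imports Defs
begin

text \<open>The multiplicativity of the trimmed homomorphism counts is already contradictory. Let \<open>G\<close> be
  the hypergraph on two vertices whose only edge is the whole vertex set, and let \<open>K = G \<boxplus> G\<close>.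
  Counting maps from one vertex, with or without an edge, shows that \<open>K\<close> has four vertices, all covered by edges. On two
  vertices \<open>0, 1\<close> with the edge \<open>{0}\<close>, only the two constant maps to \<open>G\<close> are trimmed homomorphisms,
  so the same holds for the four constant maps to \<open>K\<close>; hence no edge of \<open>K\<close> separates two vertices,
  and the only edge of \<open>K\<close> is its vertex set. On three vertices with the edge \<open>{0, 1}\<close>, a hypergraph
  of \<open>n\<close> vertices whose only edge is its vertex set admits \<open>2n\<^sup>2 - n\<close> trimmed homomorphisms, which
  gives \<open>28\<close> for \<open>K\<close> instead of \<open>6 \<cdot> 6\<close>.\<close>

lemma vertices_Abs_hypergraph [simp]:
  "finite V \<Longrightarrow> E \<subseteq> Pow V - {{}} \<Longrightarrow> vertices (Abs_hypergraph (V, E)) = V"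
  by (simp add: vertices_def Abs_hypergraph_inverse)

lemma edges_Abs_hypergraph [simp]:
  "finite V \<Longrightarrow> E \<subseteq> Pow V - {{}} \<Longrightarrow> edges (Abs_hypergraph (V, E)) = E"
  by (simp add: edges_def Abs_hypergraph_inverse)

lemma finite_vertices: "finite (vertices G)"
  using Rep_hypergraph[of G] by (auto simp: vertices_def)

lemma edges_subset: "edges G \<subseteq> Pow (vertices G) - {{}}"
  using Rep_hypergraph[of G] by (simp add: vertices_def edges_def split_beta)

text \<open>Evaluation at the points of the domain is a bijection from extensional maps to tuples of
  values. This and the next two lemmas thus turn homomorphism counts into counts of tuples.\<close>

lemma card_PiE_one:
  "card {\<phi> \<in> {0::nat} \<rightarrow>\<^sub>E V. P (\<phi> 0)} = card {x \<in> V. P x}"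
  by (rule bij_betw_same_card[of "\<lambda>\<phi>. \<phi> 0"],
      rule bij_betw_byWitness[where f' = "\<lambda>x. \<lambda>i\<in>{0}. x"])
     (auto simp: fun_eq_iff PiE_iff extensional_def)

lemma card_PiE_two:
  "card {\<phi> \<in> {0::nat, 1} \<rightarrow>\<^sub>E V. P (\<phi> 0) (\<phi> 1)} = card {(x, y) \<in> V \<times> V. P x y}"
  by (rule bij_betw_same_card[of "\<lambda>\<phi>. (\<phi> 0, \<phi> 1)"],
      rule bij_betw_byWitness[where f' = "\<lambda>(x, y). \<lambda>i\<in>{0, 1}. if i = 0 then x else y"])
     (auto simp: fun_eq_iff PiE_iff extensional_def)

lemma card_PiE_three:
  "card {\<phi> \<in> {0::nat, 1, 2} \<rightarrow>\<^sub>E V. P (\<phi> 0) (\<phi> 1) (\<phi> 2)} =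
     card {(x, y, z) \<in> V \<times> V \<times> V. P x y z}"
  by (rule bij_betw_same_card[of "\<lambda>\<phi>. (\<phi> 0, \<phi> 1, \<phi> 2)"],
      rule bij_betw_byWitness[where f' = "\<lambda>(x, y, z). \<lambda>i\<in>{0, 1, 2}.
        if i = 0 then x else if i = 1 then y else z"])
     (auto simp: fun_eq_iff PiE_iff extensional_def)

lemma card_TrimHom_vertex:
  "card (TrimHom (Abs_hypergraph ({0::nat}, {})) G) = card (vertices G)"
  using card_PiE_one[of "vertices G" "\<lambda>_. True"] by (simp add: TrimHom_def)

lemma card_TrimHom_loop:
  "card (TrimHom (Abs_hypergraph ({0::nat}, {{0}})) G) = card (\<Union> (edges G))"
proof -
  have "\<Union> (edges G) = {x \<in> vertices G. \<exists>e\<in>edges G. {x} = e \<inter> {x}}"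
    using edges_subset[of G] by auto
  then show ?thesis
    using card_PiE_one[of "vertices G" "\<lambda>x. \<exists>e\<in>edges G. {x} = e \<inter> {x}"]
    by (simp add: TrimHom_def)
qed

text \<open>The map with values \<open>x, y\<close> is trimmed iff
  \<open>{x} = e \<inter> {x, y}\<close> for some edge \<open>e\<close>: either \<open>x = y\<close>
  is covered by \<open>e\<close>, or \<open>e\<close> separates \<open>x\<close> from
  \<open>y\<close>. The two cases give the two summands.\<close>

lemma card_TrimHom_two:
  "card (TrimHom (Abs_hypergraph ({0::nat, 1}, {{0}})) G) =
     card (\<Union> (edges G)) + card {(x, y). y \<in> vertices G \<and> (\<exists>e\<in>edges G. x \<in> e \<and> y \<notin> e)}"
    (is "_ = card ?C + card ?S")
proof -
  have sub: "?C \<subseteq> vertices G"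
    using edges_subset[of G] by auto
  have "?S \<subseteq> vertices G \<times> vertices G"
    using sub by auto
  then have fin: "finite ?S"
    by (rule finite_subset) (simp add: finite_vertices)
  have "{x} = e \<inter> {x, y} \<longleftrightarrow> x \<in> e \<and> (x = y \<or> y \<notin> e)" for x y :: 'a and e
    by auto
  then have eq: "{(x, y) \<in> vertices G \<times> vertices G. \<exists>e\<in>edges G. {x} = e \<inter> {x, y}} =
      (\<lambda>x. (x, x)) ` ?C \<union> ?S"
    using sub by (simp only:) blast
  have "card (TrimHom (Abs_hypergraph ({0::nat, 1}, {{0}})) G) =
      card {(x, y) \<in> vertices G \<times> vertices G. \<exists>e\<in>edges G. {x} = e \<inter> {x, y}}"
    using card_PiE_two[of "vertices G" "\<lambda>x y. \<exists>e\<in>edges G. {x} = e \<inter> {x, y}"]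
    by (simp add: TrimHom_def)
  \<comment> \<open>Pairs in \<open>?S\<close> are off the diagonal, since \<open>e\<close> contains
    only their first component.\<close>
  also have "\<dots> = card ((\<lambda>x. (x, x)) ` ?C) + card ?S"
    unfolding eq using fin finite_subset[OF sub finite_vertices]
    by (intro card_Un_disjoint) auto
  finally show ?thesis
    by (simp add: card_image inj_on_def)
qed

text \<open>The only edge traces the whole image, so the condition is
  \<open>{x, y} = {x, y, z}\<close>, that is, \<open>z = x\<close> or \<open>z = y\<close>;
  inclusion-exclusion counts these triples. Moving \<open>card (vertices G)\<close> to the left
  avoids subtraction on \<open>nat\<close>.\<close>

lemma card_TrimHom_three:
  assumes "edges G = {vertices G}"
  shows "card (TrimHom (Abs_hypergraph ({0::nat, 1, 2}, {{0, 1}})) G) + card (vertices G) =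
    2 * card (vertices G)^2"
proof -
  let ?V = "vertices G"
  let ?A = "(\<lambda>(x, y). (x, y, x)) ` (?V \<times> ?V)" and ?B = "(\<lambda>(x, y). (x, y, y)) ` (?V \<times> ?V)"
  have "TrimHom (Abs_hypergraph ({0::nat, 1, 2}, {{0, 1}})) G =
      {\<phi> \<in> {0::nat, 1, 2} \<rightarrow>\<^sub>E ?V. \<phi> 2 = \<phi> 0 \<or> \<phi> 2 = \<phi> 1}"
    using assms by (auto simp: TrimHom_def PiE_iff)
  then have "card (TrimHom (Abs_hypergraph ({0::nat, 1, 2}, {{0, 1}})) G) =
      card {(x, y, z) \<in> ?V \<times> ?V \<times> ?V. z = x \<or> z = y}"
    using card_PiE_three[of ?V "\<lambda>x y z. z = x \<or> z = y"] by simp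
  also have "{(x, y, z) \<in> ?V \<times> ?V \<times> ?V. z = x \<or> z = y} = ?A \<union> ?B"
    by auto
  finally have 1: "card (TrimHom (Abs_hypergraph ({0::nat, 1, 2}, {{0, 1}})) G) = card (?A \<union> ?B)" .
  have "?A \<inter> ?B = (\<lambda>x. (x, x, x)) ` ?V"
    by auto
  then have "card (?A \<inter> ?B) = card ?V"
    by (simp add: card_image inj_on_def)
  moreover have "card ?A = card ?V^2" "card ?B = card ?V^2"
    by (simp_all add: card_image inj_on_def card_cartesian_product power2_eq_square)
  moreover have "card ?A + card ?B = card (?A \<union> ?B) + card (?A \<inter> ?B)"
    by (rule card_Un_Int) (auto simp: finite_vertices)
  ultimately show ?thesis
    using 1 by simp
qed

lemma no_multiplicative_product:
  fixes G K :: "nat hypergraph"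
  assumes V: "card (vertices G) = 2" and E: "edges G = {vertices G}"
    and mult: "\<And>F :: nat hypergraph. card (TrimHom F K) = card (TrimHom F G) * card (TrimHom F G)"
  shows False
proof -
  let ?S = "\<lambda>L :: nat hypergraph.
    {(x, y). y \<in> vertices L \<and> (\<exists>e\<in>edges L. x \<in> e \<and> y \<notin> e)}"
  have VK: "card (vertices K) = 4"
    using mult[of "Abs_hypergraph ({0}, {})"] by (simp only: card_TrimHom_vertex V)
  have CK: "card (\<Union> (edges K)) = 4"
    using mult[of "Abs_hypergraph ({0}, {{0}})"] by (simp only: card_TrimHom_loop) (simp add: E V)
  have "?S G = {}"
    by (auto simp: E)
  \<comment> \<open>Multiplicativity reads
    \<open>4 + card (?S K) = (2 + 0) * (2 + 0)\<close>.\<close>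
  then have "card (?S K) = 0"
    using mult[of "Abs_hypergraph ({0, 1}, {{0}})"]
    by (simp only: card_TrimHom_two CK) (simp add: E V)
  moreover have "?S K \<subseteq> vertices K \<times> vertices K"
    using edges_subset[of K] by auto
  then have "finite (?S K)"
    by (rule finite_subset) (simp add: finite_vertices)
  ultimately have "?S K = {}"
    by simp
  have "e = vertices K" if e: "e \<in> edges K" for e
  proof
    show "e \<subseteq> vertices K"
      using e edges_subset[of K] by auto
    \<comment> \<open>Edges are nonempty, so \<open>e\<close> would separate some \<open>x\<close>
      from any vertex outside it.\<close>
    obtain x where "x \<in> e"
      using e edges_subset[of K] by auto
    then have "(x, y) \<in> ?S K" if "y \<in> vertices K" "y \<notin> e" for y
      using e that by auto
    then show "vertices K \<subseteq> e"
      unfolding \<open>?S K = {}\<close> by blast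
  qed
  \<comment> \<open>The previous claim is vacuous for an edgeless \<open>K\<close>; the four covered
    vertices exclude that case.\<close>
  moreover have "edges K \<noteq> {}"
    using CK by auto
  ultimately have "edges K = {vertices K}"
    by auto
  from card_TrimHom_three[OF this] card_TrimHom_three[OF E]
  show False
    using mult[of "Abs_hypergraph ({0, 1, 2}, {{0, 1}})"] by (simp add: V VK)
qed

theorem theorem6p2:
  assumes "FPT_neq_sharpW2"
  shows "\<not> (\<exists>p :: hypergraph_product.
            associative_product p \<and>
            fpt_product p \<and>
            (\<forall>(F :: nat hypergraph) (G :: nat hypergraph) (H :: nat hypergraph).
               card (TrimHom F (p G H)) = card (TrimHom F G) * card (TrimHom F H)))"
proof -
  define G :: "nat hypergraph" where "G = Abs_hypergraph ({0, 1}, {{0, 1}})"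
  have "card (vertices G) = 2" "edges G = {vertices G}"
    by (simp_all add: G_def)
  \<comment> \<open>Here \<open>K\<close> is \<open>p G G\<close>.\<close>
  then show ?thesis
    using no_multiplicative_product[of G] by blast
qed

end
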